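(* The following hold. (1) For any polynomial $f \in \mathbb{Z}[x]$ of degree $d \le 36$ with odd leading coefficient and odd constant coefficient, there exists a square-free polynomial $g \in \mathbb{Z}[x]$ of degree $d$ such that $L(f-g) \le 1$. (2) For any polynomial $f \in \mathbb{Z}[x]$ of degree $d \le 37$ with odd leading coefficient and even constant term, such that $0$ is a simple root of the reduction of $f$ modulo $2$, there exists a square-free polynomial $g \in \mathbb{Z}[x]$ of degree $d$ such that $L(f-g) \le 1$. (3) For any polynomial $f \in \mathbb{Z}[x]$ of degree $d \le 81$ with odd leading coefficient and odd constant coefficient, there exists a square-free polynomial $g \in \mathbb{Z}[x]$ of degree $d$ such that $L(f-g) \le 3$. (4) Let $f \in \mathbb{Z}[x]$ have degree $d \ge 9$ and odd leading coefficient, and let $\bar f(x) = \sum_{i=0}^{d} a_i x^i \in \mathbb{F}_2[x]$ be its reduction modulo $2$, with $\bar f_e(x) = \sum_{i=0}^{\lfloor d/2 \rfloor} a_{2i} x^i$ and $\bar f_o(x) = \sum_{i=0}^{\lfloor (d-1)/2 \rfloor} a_{2i+1} x^i$. Suppose that either (i) $\bar f_e$ is not divisible by any of $x, x+1, x^2+x+1$ in $\mathbb{F}_2[x]$ and $\bar f_o$ has at most $5$ distinct irreducible factors, or (ii) $\bar f_o$ is not divisible by any of $x, x+1, x^2+x+1$ and $\bar f_e$ has at most $5$ distinct irreducible factors. Then there exists a square-free polynomial $g \in \mathbb{Z}[x]$ of degree $d$ such that $L(f-g) \le 1$.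
   Context: For $h(x) = a_n x^n + \cdots + a_0 \in \mathbb{Z}[x]$, its length is $L(h) = |a_n| + \cdots + |a_0|$. A polynomial $g \in \mathbb{Z}[x]$ is called square-free if there is no polynomial $h \in \mathbb{Z}[x]$ of degree at least $1$ such that $h^2$ divides $g$. $\mathbb{F}_2$ is the field with two elements. *)

theory Defs
  imports "HOL-Computational_Algebra.Polynomial" "HOL-Library.Z2"
begin

definition poly_length :: "int poly \<Rightarrow> int" where
  "poly_length h = (\<Sum>i\<le>degree h. \<bar>coeff h i\<bar>)"

text \<open>
  Only squares of non-constant polynomials are forbidden. The library predicate
  \<open>squarefree\<close> on \<open>int poly\<close> is stronger: it also forbids squares of
  non-unit integer constants.
\<close>

definition square_free_poly :: "int poly \<Rightarrow> bool" where
  "square_free_poly g \<longleftrightarrow> \<not> (\<exists>h. degree h \<ge> 1 \<and> h ^ 2 dvd g)"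

definition reduce_mod2 :: "int poly \<Rightarrow> bit poly" where
  "reduce_mod2 f = map_poly of_int f"

definition even_part :: "'a::comm_monoid_add poly \<Rightarrow> 'a poly" where
  "even_part p = (\<Sum>i\<le>degree p div 2. monom (coeff p (2 * i)) i)"

definition odd_part :: "'a::comm_monoid_add poly \<Rightarrow> 'a poly" where
  "odd_part p = (\<Sum>i\<le>(degree p - 1) div 2. monom (coeff p (2 * i + 1)) i)"

text \<open>
  The only unit of \<open>bit poly\<close> is \<open>1\<close>, so distinct elements of this set are
  non-associated. The set is infinite for \<open>p = 0\<close>.
\<close>

definition irreducible_factors :: "bit poly \<Rightarrow> bit poly set" where
  "irreducible_factors p = {q. irreducible q \<and> q dvd p}"

definition no_small_factor :: "bit poly \<Rightarrow> bool" where
  "no_small_factor p \<longleftrightarrow> \<not> [:0, 1:] dvd p \<and> \<not> [:1, 1:] dvd p \<and> \<not> [:1, 1, 1:] dvd p"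

lemma degree_reduce_mod2:
  assumes "odd (lead_coeff f)"
  shows "degree (reduce_mod2 f) = degree f"
proof -
  have "(of_int (lead_coeff f) :: bit) = 1"
    using assms by (auto elim!: oddE)
  then show ?thesis
    unfolding reduce_mod2_def by (intro map_poly_degree_eq) auto
qed

lemma coeff_even_part: "coeff (even_part p) i = coeff p (2 * i)"
  by (auto simp: even_part_def coeff_sum coeff_monom intro!: coeff_eq_0)

lemma coeff_odd_part: "coeff (odd_part p) i = coeff p (2 * i + 1)"
  by (auto simp: odd_part_def coeff_sum coeff_monom intro!: coeff_eq_0)

end

theory Submission
  imports Defs "HOL-Computational_Algebra.Polynomial_Factorial"
begin

text \<open>
  Over the field with two elements \<open>F = E\<^sup>2 + X O\<^sup>2\<close> with \<open>E\<close>, \<open>O\<close> the even and odd part, and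
  \<open>F' = O\<^sup>2\<close>; so \<open>f\<close> is square-free once \<open>E\<close> and \<open>O\<close> are coprime. The common factor \<open>X + 1\<close> is harmless,
  since the sign of the perturbation \<open>\<plusminus>x\<^sup>j\<close> can be chosen such that \<open>4\<close> does not divide the value at
  \<open>1\<close>. Adding \<open>X\<^sup>i\<close> to one part, say \<open>Q\<close>, an irreducible factor \<open>p \<noteq> X, X + 1\<close> of the other part \<open>P\<close>
  excludes at most one residue class of exponents \<open>i\<close> modulo the order \<open>e\<close> of \<open>X\<close> modulo \<open>p\<close>, where
  \<open>e\<close> divides \<open>2\<^bsup>deg p\<^esup> - 1\<close>. As the degrees of these factors add up to at most the number of
  available exponents, few classes have a small modulus, and they do not cover all exponents. The
  expensive factor is \<open>X\<^sup>2 + X + 1\<close>, with \<open>e = 3\<close>: up to \<open>18\<close> exponents one exploits that its class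
  meets the others, and up to \<open>40\<close> one first removes it from the even part by adding \<open>x\<^sup>2\<close>.
  At most five classes never cover \<open>18\<close> consecutive exponents.
\<close>

section \<open>Polynomials over the field with two elements\<close>

lemma bit_poly_add_self [simp]: "p + p = (0 :: bit poly)"
proof (rule poly_eqI)
  show "coeff (p + p) n = coeff 0 n" for n
    unfolding coeff_add coeff_0 by (cases "coeff p n") simp_all
qed

lemma bit_poly_uminus [simp]: "- p = (p :: bit poly)"
  by (rule poly_eqI) simp

lemma bit_poly_diff [simp]: "p - q = p + (q :: bit poly)"
  by (rule poly_eqI) simp

lemma bit_poly_add_left_cancel [simp]: "p + (p + q) = (q :: bit poly)"
  by (simp flip: add.assoc)

lemma bit_poly_unit_iff: "p dvd 1 \<longleftrightarrow> p = (1 :: bit poly)"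
proof
  assume "p dvd 1"
  then obtain c where "p = [:c:]" "c dvd 1"
    by (auto simp: is_unit_poly_iff)
  then show "p = 1"
    by (cases c) auto
qed simp

lemma bit_poly_irreducible_imp_prime: "irreducible p \<Longrightarrow> prime_elem (p :: bit poly)"
  by (rule field_poly_irreducible_imp_prime)

lemma bit_poly_irreducible_degree_pos:
  assumes "irreducible (p :: bit poly)"
  shows "0 < degree p"
proof (rule ccontr)
  assume "\<not> 0 < degree p"
  moreover have "p \<noteq> 0" "\<not> p dvd 1"
    using assms by (auto simp: irreducible_def)
  ultimately show False
    by (simp add: is_unit_iff_degree)
qed

lemma bit_poly_irreducible_dvd_irreducible:
  fixes p q :: "bit poly"
  assumes "irreducible p" "irreducible q" "p dvd q"
  shows "p = q"
proof -
  obtain c where c: "q = p * c"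
    using assms(3) by blast
  have "\<not> p dvd 1"
    using assms(1) by (auto simp: irreducible_def)
  with c assms(2) have "c dvd 1"
    by (auto simp: irreducible_def)
  with c show ?thesis
    by (simp add: bit_poly_unit_iff)
qed

lemma bit_poly_dvd_same_degree:
  fixes p q :: "bit poly"
  assumes "p dvd q" "q \<noteq> 0" "degree q \<le> degree p"
  shows "p = q"
proof -
  obtain c where c: "q = p * c"
    using assms(1) by blast
  with assms(2) have "p \<noteq> 0" "c \<noteq> 0"
    by auto
  with assms(3) c have "degree c = 0"
    by (simp add: degree_mult_eq)
  with \<open>c \<noteq> 0\<close> have "c dvd 1"
    by (simp add: is_unit_iff_degree)
  with c show ?thesis
    by (simp add: bit_poly_unit_iff)
qed

lemma irreducible_X_bit: "irreducible ([:0, 1:] :: bit poly)"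
  by (rule irreducible_linear_field_poly) simp

lemma irreducible_X_plus_1_bit: "irreducible ([:1, 1:] :: bit poly)"
  by (rule irreducible_linear_field_poly) simp

lemma exists_irreducible_factor_bit:
  fixes p :: "bit poly"
  assumes "0 < degree p"
  shows "\<exists>q. irreducible q \<and> q dvd p"
  using assms
proof (induction "degree p" arbitrary: p rule: less_induct)
  case less
  show ?case
  proof (cases "irreducible p")
    case False
    have "p \<noteq> 0"
      using less.prems by auto
    moreover from this have "\<not> p dvd 1"
      using less.prems by (simp add: is_unit_iff_degree)
    ultimately obtain a b where ab: "p = a * b" "\<not> a dvd 1" "\<not> b dvd 1"
      using False
      by (auto simp: irreducible_def)
    with \<open>p \<noteq> 0\<close> have "a \<noteq> 0" "b \<noteq> 0"
      by auto
    with ab have "0 < degree a" "0 < degree b"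
      by (auto simp: is_unit_iff_degree)
    with ab \<open>a \<noteq> 0\<close> \<open>b \<noteq> 0\<close> have "degree a < degree p"
      by (simp add: degree_mult_eq)
    from less.hyps[OF this \<open>0 < degree a\<close>] ab(1) show ?thesis
      by (blast intro: dvd_mult2)
  qed auto
qed

lemma bit_poly_irreducible_dvd_prod:
  fixes p :: "bit poly"
  assumes "irreducible p" "finite T" "p dvd \<Prod>T"
  shows "\<exists>q\<in>T. p dvd q"
  using assms(2,3)
proof (induction T)
  case empty
  then show ?case
    using assms(1) by (simp add: irreducible_def)
next
  case (insert q T)
  then show ?case
    using prime_elem_dvd_multD[OF bit_poly_irreducible_imp_prime[OF assms(1)]] by auto
qed

text \<open>Since \<open>1\<close> is the only unit, distinct irreducibles are never associated;
  hence the next prime divides the cofactor left by the previous ones.\<close>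

lemma prod_irreducible_dvd_bit:
  fixes P :: "bit poly"
  assumes "finite T" "\<And>p. p \<in> T \<Longrightarrow> irreducible p \<and> p dvd P"
  shows "\<Prod>T dvd P"
  using assms
proof (induction T)
  case (insert p T)
  then have "\<Prod>T dvd P"
    by blast
  then obtain c where c: "P = \<Prod>T * c"
    by blast
  have p: "irreducible p" "p dvd P" "prime_elem p"
    using insert.prems by (auto intro: bit_poly_irreducible_imp_prime)
  have "\<not> p dvd \<Prod>T"
  proof
    assume "p dvd \<Prod>T"
    then obtain q where "q \<in> T" "p dvd q"
      using bit_poly_irreducible_dvd_prod p(1) insert.hyps(1) by blast
    then show False
      using bit_poly_irreducible_dvd_irreducible[of p q] insert p by auto
  qed
  with p c have "p dvd c"
    using prime_elem_dvd_mult_iff by blast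
  with c show ?case
    using insert.hyps by (auto simp: mult.commute[of p] intro: mult_dvd_mono)
qed auto

lemma sum_degree_irreducible_le_bit:
  fixes P :: "bit poly"
  assumes "P \<noteq> 0" "finite T" "\<And>p. p \<in> T \<Longrightarrow> irreducible p \<and> p dvd P"
  shows "(\<Sum>p\<in>T. degree p) \<le> degree P"
proof -
  have "(\<Sum>p\<in>T. degree p) = degree (\<Prod>T)"
    using assms(3) by (subst degree_prod_eq_sum_degree) (auto simp: irreducible_def)
  also have "\<dots> \<le> degree P"
    using assms by (intro dvd_imp_degree_le prod_irreducible_dvd_bit)
  finally show ?thesis .
qed

text \<open>Each step chooses one more constant coefficient via \<open>pCons\<close>. The disjunct
  \<open>p = 0\<close> makes the count \<open>1\<close> at \<open>m = 0\<close>.\<close>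

lemma finite_card_bit_poly_degree_less:
  "finite {p :: bit poly. p = 0 \<or> degree p < m} \<and> card {p :: bit poly. p = 0 \<or> degree p < m} = 2 ^ m"
proof (induction m)
  case (Suc m)
  let ?B = "\<lambda>m. {p :: bit poly. p = 0 \<or> degree p < m}"
  have U: "(UNIV :: bit set) = {0, 1}"
    by (auto intro: bit.exhaust)
  have eq: "?B (Suc m) = (\<lambda>(a, p). pCons a p) ` (UNIV \<times> ?B m)"
  proof (intro equalityI subsetI)
    fix p assume "p \<in> ?B (Suc m)"
    then show "p \<in> (\<lambda>(a, p). pCons a p) ` (UNIV \<times> ?B m)"
      by (cases p) (auto split: if_splits)
  qed (auto split: if_splits)
  have inj: "inj_on (\<lambda>(a, p). pCons a p) (UNIV \<times> ?B m)"
    by (auto simp: inj_on_def)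
  have fin: "finite ((UNIV :: bit set) \<times> ?B m)"
    using Suc by (intro finite_SigmaI) (simp_all add: U)
  have "card (UNIV :: bit set) = 2"
    by (simp add: U)
  then have "card ((UNIV :: bit set) \<times> ?B m) = 2 ^ Suc m"
    using Suc by (simp only: card_cartesian_product power_Suc)
  then show ?case
    unfolding eq card_image[OF inj] by (intro conjI finite_imageI fin)
qed auto

lemma finite_irreducible_factors:
  assumes "P \<noteq> 0"
  shows "finite (irreducible_factors P)"
proof -
  have "irreducible_factors P \<subseteq> {p. p = 0 \<or> degree p < Suc (degree P)}"
    using assms by (auto simp: irreducible_factors_def dest: dvd_imp_degree_le)
  with finite_card_bit_poly_degree_less show ?thesis
    by (blast intro: finite_subset)
qed

text \<open>Euclid's argument with \<open>1 + X * D\<close>, where \<open>D\<close> is the product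
  of all irreducibles; the factor \<open>X\<close> makes the degree positive.\<close>

lemma infinite_irreducible_bit: "infinite {p :: bit poly. irreducible p}"
proof
  assume fin: "finite {p :: bit poly. irreducible p}"
  let ?D = "\<Prod>{p :: bit poly. irreducible p}"
  have "?D \<noteq> 0"
    using fin by (auto simp: irreducible_def)
  then have "0 < degree (pCons 1 ?D)"
    by auto
  then obtain q where q: "irreducible q" "q dvd pCons 1 ?D"
    using exists_irreducible_factor_bit by blast
  have "pCons 1 ?D = 1 + [:0, 1:] * ?D"
    by (subst one_pCons) (simp del: one_poly_eq_simps)
  moreover have "q dvd ?D"
    using fin q(1) by (intro dvd_prodI) auto
  ultimately have "q dvd 1"
    using q(2) by (metis dvd_add_left_iff dvd_mult)
  with q(1) show False
    by (simp add: irreducible_def)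
qed

text \<open>Turns the finiteness hypothesis of the fourth statement into
  \<open>P \<noteq> 0\<close>.\<close>

lemma irreducible_factors_0: "infinite (irreducible_factors 0)"
  using infinite_irreducible_bit by (simp only: irreducible_factors_def dvd_0_right simp_thms)

section \<open>The multiplicative order of \<open>X\<close> modulo an irreducible polynomial\<close>

abbreviation Xp :: "nat \<Rightarrow> bit poly" where
  "Xp k \<equiv> monom 1 k"

lemma irreducible_dvd_Xp_bit:
  assumes "irreducible p" "p dvd Xp k"
  shows "p = [:0, 1:]"
proof -
  have "prime_elem p"
    using assms(1) by (rule bit_poly_irreducible_imp_prime)
  with assms(2) have "p dvd [:0, 1:]"
    by (auto simp: monom_altdef intro: prime_elem_dvd_power)
  with assms(1) irreducible_X_bit show ?thesis
    by (rule bit_poly_irreducible_dvd_irreducible)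
qed

text \<open>Fermat's argument: multiplication by \<open>X\<close> permutes the
  \<open>2 ^ degree p - 1\<close> nonzero residues modulo \<open>p\<close>. Comparing the products
  before and after, and cancelling a product that \<open>p\<close> does not divide, gives the
  claim.\<close>

lemma dvd_Xp_fermat:
  fixes p :: "bit poly"
  assumes p: "irreducible p" "p \<noteq> [:0, 1:]"
  shows "p dvd Xp (2 ^ degree p - 1) + 1"
proof -
  let ?R = "{q :: bit poly. q \<noteq> 0 \<and> degree q < degree p}"
  have prime: "prime_elem p"
    using p(1) by (rule bit_poly_irreducible_imp_prime)
  have "p \<noteq> 0" and deg: "0 < degree p"
    using p(1) bit_poly_irreducible_degree_pos by (auto simp: irreducible_def)
  have R: "?R = {q. q = 0 \<or> degree q < degree p} - {0}"
    by auto
  have fin: "finite ?R" and card: "card ?R = 2 ^ degree p - 1"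
    unfolding R using finite_card_bit_poly_degree_less[of "degree p"]
    by (auto simp: card_Diff_singleton)
  have ndvd: "\<not> p dvd q" if "q \<in> ?R" for q
    using that by (auto dest: dvd_imp_degree_le)
  have pX: "\<not> p dvd [:0, 1:]"
    using p irreducible_X_bit bit_poly_irreducible_dvd_irreducible by blast
  let ?f = "\<lambda>q. ([:0, 1:] * q) mod p"
  have maps: "?f q \<in> ?R" if "q \<in> ?R" for q
  proof -
    have "\<not> p dvd [:0, 1:] * q"
      using prime_elem_dvd_mult_iff[OF prime] pX ndvd[OF that] by blast
    then have "?f q \<noteq> 0"
      by (simp add: mod_eq_0_iff_dvd)
    then show ?thesis
      using degree_mod_less[OF \<open>p \<noteq> 0\<close>, of "[:0, 1:] * q"] by auto
  qed
  have inj: "inj_on ?f ?R"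
  proof (rule inj_onI)
    fix a b assume ab: "a \<in> ?R" "b \<in> ?R" "?f a = ?f b"
    then have "p dvd [:0, 1:] * a - [:0, 1:] * b"
      by (simp only: mod_eq_dvd_iff)
    then have "p dvd [:0, 1:] * (a - b)"
      by (simp only: right_diff_distrib)
    then have "p dvd a - b"
      using prime_elem_dvd_mult_iff[OF prime] pX by blast
    moreover have "degree (a - b) < degree p"
      using ab by (intro degree_diff_less) auto
    ultimately have "a - b = 0"
      using dvd_imp_degree_le leD by blast
    then show "a = b"
      by (simp only: right_minus_eq)
  qed
  have img: "?f ` ?R = ?R"
    by (rule endo_inj_surj[OF fin image_subsetI[OF maps] inj])
  have "\<Prod>?R = (\<Prod>q\<in>?R. ?f q)"
    using prod.reindex[OF inj, of "\<lambda>x. x"] img by simp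
  then have "(\<Prod>q\<in>?R. [:0, 1:] * q) mod p = \<Prod>?R mod p"
    by (metis (no_types, lifting) mod_prod_eq prod.cong)
  moreover have "(\<Prod>q\<in>?R. [:0, 1:] * q) = Xp (2 ^ degree p - 1) * \<Prod>?R"
    by (simp only: prod.distrib prod_constant card monom_altdef smult_1_left)
  ultimately have "p dvd Xp (2 ^ degree p - 1) * \<Prod>?R - \<Prod>?R"
    by (simp only: mod_eq_dvd_iff)
  then have "p dvd (Xp (2 ^ degree p - 1) + 1) * \<Prod>?R"
    by (simp add: distrib_right)
  moreover have "\<not> p dvd \<Prod>?R"
    using bit_poly_irreducible_dvd_prod[OF p(1) fin] ndvd by blast
  ultimately show ?thesis
    using prime_elem_dvd_mult_iff[OF prime] by blast
qed

definition X_order :: "bit poly \<Rightarrow> nat" where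
  "X_order p = (LEAST k. 0 < k \<and> p dvd Xp k + 1)"

lemma X_order:
  assumes "irreducible p" "p \<noteq> [:0, 1:]"
  shows X_order_pos: "0 < X_order p" and X_order_dvd: "p dvd Xp (X_order p) + 1"
proof -
  have "0 < (2 :: nat) ^ degree p - 1"
    using one_less_power[of "2 :: nat"] bit_poly_irreducible_degree_pos[OF assms(1)] by simp
  then have "0 < X_order p \<and> p dvd Xp (X_order p) + 1"
    using LeastI[of "\<lambda>k. 0 < k \<and> p dvd Xp k + 1" "2 ^ degree p - 1"] dvd_Xp_fermat[OF assms]
    by (simp add: X_order_def)
  then show "0 < X_order p" "p dvd Xp (X_order p) + 1"
    by auto
qed

text \<open>Division with remainder, one subtraction at a time: lowering \<open>k\<close> by the
  order preserves divisibility, and minimality leaves only \<open>k = 0\<close> below the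
  order.\<close>

lemma X_order_dvd_exponent:
  assumes "irreducible p" "p \<noteq> [:0, 1:]" "p dvd Xp k + 1"
  shows "X_order p dvd k"
  using assms(3)
proof (induction k rule: less_induct)
  case (less k)
  let ?e = "X_order p"
  note e = X_order[OF assms(1,2)]
  show ?case
  proof (cases "k < ?e")
    case True
    with less.prems have "k = 0"
      using not_less_Least[of k "\<lambda>k. 0 < k \<and> p dvd Xp k + 1"] by (auto simp: X_order_def)
    then show ?thesis
      by simp
  next
    case False
    then have "Xp k = Xp ?e * Xp (k - ?e)"
      by (simp add: mult_monom)
    then have "Xp k + 1 = (Xp ?e + 1) * Xp (k - ?e) + (Xp (k - ?e) + 1)"
      by (simp only: distrib_right mult_1 add.assoc bit_poly_add_left_cancel)
    with less.prems e(2) have "p dvd Xp (k - ?e) + 1"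
      by (metis dvd_add_right_iff dvd_mult2)
    with less.IH[of "k - ?e"] e(1) False have "?e dvd k - ?e"
      by auto
    then show ?thesis
      using False by (simp add: dvd_minus_self)
  qed
qed

text \<open>In the sum of the two multiples of \<open>p\<close> the summand \<open>Q\<close>
  cancels. This leaves \<open>Xp i * (Xp (j - i) + 1)\<close>, and \<open>p\<close> does not divide
  \<open>Xp i\<close>.\<close>

lemma X_order_dvd_diff:
  assumes "irreducible p" "p \<noteq> [:0, 1:]" "p dvd Q + Xp i" "p dvd Q + Xp j" "i \<le> j"
  shows "X_order p dvd j - i"
proof -
  have "p dvd (Q + Xp i) + (Q + Xp j)"
    using assms(3,4) by (rule dvd_add)
  moreover have "(Q + Xp i) + (Q + Xp j) = Xp i * (Xp (j - i) + 1)"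
    using assms(5) by (simp add: distrib_left mult_monom add.commute add.left_commute)
  moreover have "\<not> p dvd Xp i"
    using irreducible_dvd_Xp_bit assms by blast
  ultimately have "p dvd Xp (j - i) + 1"
    using prime_elem_dvd_mult_iff[OF bit_poly_irreducible_imp_prime[OF assms(1)]] by metis
  with assms show ?thesis
    by (intro X_order_dvd_exponent)
qed

text \<open>The factors of \<open>X\<^sup>k + 1\<close> for the orders \<open>3, 5, 7, 9, 15\<close>, i.e. those few irreducible
  polynomials whose order is small compared with their degree.\<close>

abbreviation Phi3 :: "bit poly" where "Phi3 \<equiv> [:1, 1, 1:]"
abbreviation Phi5 :: "bit poly" where "Phi5 \<equiv> [:1, 1, 1, 1, 1:]"
abbreviation Phi7a :: "bit poly" where "Phi7a \<equiv> [:1, 1, 0, 1:]"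
abbreviation Phi7b :: "bit poly" where "Phi7b \<equiv> [:1, 0, 1, 1:]"
abbreviation Phi9 :: "bit poly" where "Phi9 \<equiv> [:1, 0, 0, 1, 0, 0, 1:]"
abbreviation Phi15a :: "bit poly" where "Phi15a \<equiv> [:1, 1, 0, 0, 1:]"
abbreviation Phi15b :: "bit poly" where "Phi15b \<equiv> [:1, 0, 0, 1, 1:]"

lemma Xp_plus_1_factorization:
  "Xp 1 + 1 = [:1, 1:]"
  "Xp 3 + 1 = [:1, 1:] * Phi3"
  "Xp 5 + 1 = [:1, 1:] * Phi5"
  "Xp 7 + 1 = [:1, 1:] * (Phi7a * Phi7b)"
  "Xp 9 + 1 = (Xp 3 + 1) * Phi9"
  "Xp 15 + 1 = (Xp 5 + 1) * (Phi3 * (Phi15a * Phi15b))"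
  by code_simp+

text \<open>These factors restrict the exponent through their order; \<open>X\<close> is controlled
  by constant coefficients instead, and \<open>X + 1\<close> by the sign of the
  perturbation.\<close>

locale X_order_setting =
  fixes p :: "bit poly"
  assumes irred: "irreducible p" and not_X: "p \<noteq> [:0, 1:]" and not_X_plus_1: "p \<noteq> [:1, 1:]"
begin

lemma prime: "prime_elem p"
  using irred by (rule bit_poly_irreducible_imp_prime)

lemma degree_pos: "0 < degree p"
  using irred by (rule bit_poly_irreducible_degree_pos)

lemma not_dvd_X_plus_1: "\<not> p dvd [:1, 1:]"
  using irred irreducible_X_plus_1_bit not_X_plus_1 bit_poly_irreducible_dvd_irreducible by blast

lemma order_dvd: "X_order p dvd 2 ^ degree p - 1"
  using irred not_X dvd_Xp_fermat by (blast intro: X_order_dvd_exponent)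

lemma order_ne_1: "X_order p \<noteq> 1"
  using X_order_dvd[OF irred not_X] not_dvd_X_plus_1 by (auto simp: Xp_plus_1_factorization(1)[simplified])

lemma odd_order: "odd (X_order p)"
proof -
  have "odd ((2 :: nat) ^ degree p - 1)"
    using degree_pos by simp
  with order_dvd show ?thesis
    by (meson dvd_trans)
qed

lemma order_cases: "X_order p \<in> {3, 5, 7} \<or> 9 \<le> X_order p"
proof -
  obtain k where k: "X_order p = 2 * k + 1"
    using odd_order by (rule oddE)
  with order_ne_1 have "k \<noteq> 0"
    by (intro notI) simp
  with k show ?thesis
    by simp arith
qed

lemma not_dvd_Xp_plus_1: "0 < k \<Longrightarrow> k < X_order p \<Longrightarrow> \<not> p dvd Xp k + 1"
  using X_order_dvd_exponent[OF irred not_X] by (meson dvd_imp_le not_less)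

text \<open>The order divides \<open>2 ^ degree p - 1\<close>, so the third hypothesis rules out
  every degree below that of \<open>q\<close>; a divisor of full degree equals
  \<open>q\<close>.\<close>

lemma eq_by_order:
  assumes "p dvd q" "q \<noteq> 0" "\<And>m. 0 < m \<Longrightarrow> m < degree q \<Longrightarrow> \<not> X_order p dvd 2 ^ m - 1"
  shows "p = q"
proof (rule bit_poly_dvd_same_degree[OF assms(1,2)])
  show "degree q \<le> degree p"
    using assms(3) order_dvd degree_pos not_less by blast
qed

lemma order_3: "X_order p = 3 \<Longrightarrow> p = Phi3"
proof (rule eq_by_order)
  assume e: "X_order p = 3"
  show "p dvd Phi3"
    using X_order_dvd[OF irred not_X] not_dvd_X_plus_1
    unfolding e Xp_plus_1_factorization prime_elem_dvd_mult_iff[OF prime] by blast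
  show "\<not> X_order p dvd 2 ^ m - 1" if "0 < m" "m < degree Phi3" for m
  proof -
    have "m = 1" using that by auto
    with e show ?thesis by simp
  qed
qed simp

lemma order_5: "X_order p = 5 \<Longrightarrow> p = Phi5"
proof (rule eq_by_order)
  assume e: "X_order p = 5"
  show "p dvd Phi5"
    using X_order_dvd[OF irred not_X] not_dvd_X_plus_1
    unfolding e Xp_plus_1_factorization prime_elem_dvd_mult_iff[OF prime] by blast
  show "\<not> X_order p dvd 2 ^ m - 1" if "0 < m" "m < degree Phi5" for m
  proof -
    have "m = 1 \<or> m = 2 \<or> m = 3" using that by auto
    with e show ?thesis by auto
  qed
qed simp

lemma order_7: "X_order p = 7 \<Longrightarrow> p = Phi7a \<or> p = Phi7b"
proof -
  assume e: "X_order p = 7"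
  have *: "p dvd Phi7a \<or> p dvd Phi7b"
    using X_order_dvd[OF irred not_X] not_dvd_X_plus_1
    unfolding e Xp_plus_1_factorization prime_elem_dvd_mult_iff[OF prime] by blast
  have **: "p = q" if "p dvd q" "degree q = 3" for q
  proof (rule eq_by_order)
    show "\<not> X_order p dvd 2 ^ m - 1" if "0 < m" "m < degree q" for m
    proof -
      have "m = 1 \<or> m = 2" using that \<open>degree q = 3\<close> by auto
      with e show ?thesis by auto
    qed
  qed (use that in auto)
  have "degree Phi7a = 3" "degree Phi7b = 3"
    by simp_all
  with * ** show ?thesis
    by blast
qed

lemma order_9: "X_order p = 9 \<Longrightarrow> p = Phi9"
proof (rule eq_by_order)
  assume e: "X_order p = 9"
  \<comment> \<open>Otherwise the order would be at most \<open>3\<close>; so \<open>p\<close>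
    divides the other factor of \<open>Xp 9 + 1\<close>.\<close>
  have "\<not> p dvd Xp 3 + 1"
    using e by (intro not_dvd_Xp_plus_1) auto
  then show "p dvd Phi9"
    using X_order_dvd[OF irred not_X]
    unfolding e Xp_plus_1_factorization(5) prime_elem_dvd_mult_iff[OF prime] by blast
  show "\<not> X_order p dvd 2 ^ m - 1" if "0 < m" "m < degree Phi9" for m
  proof -
    have "m = 1 \<or> m = 2 \<or> m = 3 \<or> m = 4 \<or> m = 5" using that by auto
    with e show ?thesis by auto
  qed
qed simp

lemma order_15: "X_order p = 15 \<Longrightarrow> p = Phi15a \<or> p = Phi15b"
proof -
  assume e: "X_order p = 15"
  have "\<not> p dvd Xp 3 + 1" "\<not> p dvd Xp 5 + 1"
    using e by (intro not_dvd_Xp_plus_1; simp)+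
  then have "\<not> p dvd Phi3" "\<not> p dvd Xp 5 + 1"
    by (auto simp only: Xp_plus_1_factorization(2) dvd_mult)
  then have *: "p dvd Phi15a \<or> p dvd Phi15b"
    using X_order_dvd[OF irred not_X]
    unfolding e Xp_plus_1_factorization(6) prime_elem_dvd_mult_iff[OF prime] by blast
  have **: "p = q" if "p dvd q" "degree q = 4" for q
  proof (rule eq_by_order)
    show "\<not> X_order p dvd 2 ^ m - 1" if "0 < m" "m < degree q" for m
    proof -
      have "m = 1 \<or> m = 2 \<or> m = 3" using that \<open>degree q = 4\<close> by auto
      with e show ?thesis by auto
    qed
  qed (use that in auto)
  have "degree Phi15a = 4" "degree Phi15b = 4"
    by simp_all
  with * ** show ?thesis
    by blast
qed

end

text \<open>The quotients are the ceilings of \<open>40 / e\<close> and \<open>18 / e\<close>, which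
  bound the excluded exponents; they are compared with \<open>2 / 5\<close> and \<open>1 / 3\<close>
  of the degree. For \<open>e = 15\<close>, \<open>m = 4\<close> the first comparison fails.\<close>

lemma order_table:
  "\<forall>e\<in>{11..<40}. \<forall>m\<in>{1..<13}. e \<noteq> 15 \<longrightarrow> e dvd (2 :: nat) ^ m - 1 \<longrightarrow>
     5 * ((39 + e) div e) \<le> 2 * m \<and> 3 * ((17 + e) div e) \<le> m"
  by (simp add: atLeastLessThan_nat_numeral)

context X_order_setting
begin

lemma large_order:
  assumes "X_order p \<notin> {3, 5, 7, 9, 15}"
  shows "11 \<le> X_order p"
    and "5 * ((39 + X_order p) div X_order p) \<le> 2 * degree p"
    and "3 * ((17 + X_order p) div X_order p) \<le> degree p"
proof -
  let ?e = "X_order p" and ?m = "degree p"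
  show e: "11 \<le> ?e"
  proof (rule ccontr)
    assume "\<not> 11 \<le> ?e"
    then have "?e \<in> {0, 2, 4, 6, 8, 10} \<or> ?e = 1"
      using assms by simp arith
    with odd_order order_ne_1 show False
      by auto
  qed
  have "5 * ((39 + ?e) div ?e) \<le> 2 * ?m \<and> 3 * ((17 + ?e) div ?e) \<le> ?m"
  proof (cases "?m < 13")
    case m: True
    show ?thesis
    proof (cases "?e < 40")
      case True
      with m e degree_pos order_dvd assms order_table show ?thesis
        by auto
    next
      case False
      \<comment> \<open>An order of at least \<open>40\<close> excludes at most one exponent in
        either window, and a degree of at least \<open>3\<close> pays for it.\<close>
      then have "(39 + ?e) div ?e \<le> 1" "(17 + ?e) div ?e \<le> 1"
        by (simp_all add: less_Suc_eq_le[symmetric] div_less_iff_less_mult)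
      moreover have "3 \<le> ?m"
      proof (rule ccontr)
        assume "\<not> 3 \<le> ?m"
        with degree_pos have "?m = 1 \<or> ?m = 2"
          by auto
        with order_dvd have "?e dvd 1 \<or> ?e dvd 3"
          by auto
        with e show False
          by (auto dest: dvd_imp_le)
      qed
      ultimately show ?thesis
        by linarith
    qed
  next
    case False
    \<comment> \<open>From degree \<open>13\<close> on, the crude bounds following from
      \<open>11 \<le> ?e\<close> suffice.\<close>
    have "(39 + ?e) div ?e \<le> 4" "(17 + ?e) div ?e \<le> 2"
      using e by (simp_all add: less_Suc_eq_le[symmetric] div_less_iff_less_mult)
    with False show ?thesis
      by linarith
  qed
  then show "5 * ((39 + ?e) div ?e) \<le> 2 * ?m" "3 * ((17 + ?e) div ?e) \<le> ?m"
    by auto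
qed

end

section \<open>Counting excluded exponents\<close>

lemma exists_avoiding:
  assumes "finite S" "finite V" "(\<Sum>p\<in>S. card (V \<inter> H p)) < card V"
  shows "\<exists>i\<in>V. \<forall>p\<in>S. i \<notin> H p"
proof (rule ccontr)
  assume "\<not> ?thesis"
  then have "V \<subseteq> (\<Union>p\<in>S. V \<inter> H p)"
    by blast
  then have "card V \<le> card (\<Union>p\<in>S. V \<inter> H p)"
    using assms by (intro card_mono) auto
  also have "\<dots> \<le> (\<Sum>p\<in>S. card (V \<inter> H p))"
    using assms(1) by (rule card_UN_le)
  finally show False
    using assms(3) by simp
qed

text \<open>The bound is the ceiling of \<open>n / e\<close>: each block of length \<open>e\<close>,
  counted from \<open>a\<close>, contains at most one element of \<open>H\<close>.\<close>

lemma card_residue_class_le: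
  fixes e n a :: nat
  assumes "0 < e" "H \<subseteq> {a..<a + n}" "\<And>i j. i \<in> H \<Longrightarrow> j \<in> H \<Longrightarrow> i \<le> j \<Longrightarrow> e dvd j - i"
  shows "card H \<le> (n + e - 1) div e"
proof -
  have inj: "inj_on (\<lambda>i. (i - a) div e) H"
  proof (rule linorder_inj_onI)
    fix i j assume ij: "i < j" "i \<in> H" "j \<in> H"
    then obtain k where k: "j - i = e * k"
      using assms(3)[of i j] by auto
    with ij(1) have "k \<noteq> 0"
      by (intro notI) simp
    moreover have "j - a = (i - a) + e * k"
      using k ij assms(2) by (auto simp: subset_iff)
    ultimately show "(i - a) div e \<noteq> (j - a) div e"
      using assms(1) by simp
  qed auto
  have "(i - a) div e < (n + e - 1) div e" if "i \<in> H" for i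
  proof -
    have "i - a + e \<le> n + e - 1"
      using that assms(2) by (auto simp: subset_iff)
    then have "(i - a + e) div e \<le> (n + e - 1) div e"
      by (rule div_le_mono)
    moreover have "(i - a + e) div e = (i - a) div e + 1"
      using assms(1) by simp
    ultimately show ?thesis
      by simp
  qed
  then have "card H \<le> card {..<(n + e - 1) div e}"
    by (intro card_inj_on_le[OF inj]) auto
  then show ?thesis
    by simp
qed

text \<open>As \<open>e\<close> is invertible modulo \<open>3\<close>, three consecutive terms
  represent all classes.\<close>

lemma progression_meets_class_mod_3:
  fixes b e r :: nat
  assumes "\<not> 3 dvd e"
  shows "\<exists>t<3. (b + e * t) mod 3 = r mod 3"
proof -
  define B E R where "B = b mod 3" and "E = e mod 3" and "R = r mod 3"
  have eq: "(b + e * t) mod 3 = (B + E * t) mod 3" for t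
    by (intro mod_add_cong) (simp_all add: B_def E_def mod_mult_left_eq)
  have "B < 3" "R < 3" "E < 3" "E \<noteq> 0"
    using assms by (simp_all add: B_def E_def R_def dvd_eq_mod_eq_0)
  then have "B \<in> {0, 1, 2}" "R \<in> {0, 1, 2}" "E \<in> {1, 2}"
    by auto
  then have "\<exists>t\<in>{0, 1, 2}. (B + E * t) mod 3 = R"
    by (elim insertE emptyE) simp_all
  then obtain t where "t \<in> {0, 1, 2}" "(B + E * t) mod 3 = R" ..
  then show ?thesis
    unfolding eq R_def[symmetric] by (intro exI[of _ t]) auto
qed

text \<open>From \<open>Min H\<close> on, the progression has at most \<open>k\<close> terms in the
  window. One of its first three terms lies in the forbidden class modulo \<open>3\<close>, and
  \<open>3 \<le> k\<close> ensures that it is among the \<open>k\<close> counted.\<close>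

lemma card_residue_class_avoiding_le:
  fixes e n a k r :: nat
  assumes "\<not> 3 dvd e" "H \<subseteq> {a..<a + n}" "\<And>i j. i \<in> H \<Longrightarrow> j \<in> H \<Longrightarrow> i \<le> j \<Longrightarrow> e dvd j - i"
    and "\<And>i. i \<in> H \<Longrightarrow> i mod 3 \<noteq> r mod 3" and "n \<le> k * e" "3 \<le> k"
  shows "card H \<le> k - 1"
proof (cases "H = {}")
  case False
  have "finite H"
    using assms(2) by (rule finite_subset) simp
  define b where "b = Min H"
  have b: "b \<in> H" "\<And>j. j \<in> H \<Longrightarrow> b \<le> j"
    using \<open>finite H\<close> False by (auto simp: b_def)
  obtain t0 where t0: "t0 < 3" "(b + e * t0) mod 3 = r mod 3"
    using progression_meets_class_mod_3[OF assms(1)] by blast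
  have "H \<subseteq> (\<lambda>t. b + e * t) ` ({..<k} - {t0})"
  proof
    fix j assume j: "j \<in> H"
    then obtain t where t: "j - b = e * t"
      using assms(3)[of b j] b by auto
    with b(2)[OF j] have jt: "j = b + e * t"
      by simp
    have "j \<in> {a..<a + n}" "b \<in> {a..<a + n}"
      using j b(1) assms(2) by blast+
    with jt have "e * t < n"
      by simp
    with assms(5) have "e * t < k * e"
      by linarith
    then have "t < k"
      by (simp add: mult.commute[of k])
    moreover have "t \<noteq> t0"
      using assms(4)[OF j] t0 jt by auto
    ultimately show "j \<in> (\<lambda>t. b + e * t) ` ({..<k} - {t0})"
      using jt by auto
  qed
  then have "card H \<le> card ({..<k} - {t0})"
    by (meson card_image_le card_mono finite_Diff finite_imageI finite_lessThan le_trans)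
  also have "\<dots> = k - 1"
    using t0 assms(6) by simp
  finally show ?thesis .
qed simp

text \<open>Serves to replace an unknown set of factors by the explicit list of exceptional
  polynomials.\<close>

lemma sum_le_sum_support:
  fixes t :: "'a \<Rightarrow> nat"
  assumes "finite S" "finite T" "\<And>p. p \<in> S \<Longrightarrow> p \<notin> T \<Longrightarrow> t p = 0"
  shows "(\<Sum>p\<in>S. t p) \<le> (\<Sum>p\<in>T. t p)"
proof -
  have "(\<Sum>p\<in>S. t p) = (\<Sum>p\<in>S \<inter> T. t p)"
    using assms by (intro sum.mono_neutral_right) auto
  also have "\<dots> \<le> (\<Sum>p\<in>T. t p)"
    using assms by (intro sum_mono2) auto
  finally show ?thesis .
qed

section \<open>Exponents excluded by a factor, and estimates showing that some exponent
  remains\<close>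

definition hits :: "bit poly \<Rightarrow> bit poly \<Rightarrow> nat set" where
  "hits Q p = {i. p dvd Q + Xp i}"

lemma hits_diff:
  assumes "X_order_setting p" "i \<in> hits Q p" "j \<in> hits Q p" "i \<le> j"
  shows "X_order p dvd j - i"
proof -
  interpret X_order_setting p by fact
  show ?thesis
    using X_order_dvd_diff[OF irred not_X _ _ assms(4)] assms(2,3) by (auto simp: hits_def)
qed

lemma card_hits_le:
  assumes "X_order_setting p" "V \<subseteq> {a..<a + n}"
  shows "card (V \<inter> hits Q p) \<le> (n + X_order p - 1) div X_order p"
proof -
  interpret X_order_setting p by fact
  show ?thesis
    using assms hits_diff by (intro card_residue_class_le[OF X_order_pos[OF irred not_X]]) auto
qed

lemma card_hits_avoiding_le:
  assumes "X_order_setting p" "V \<subseteq> {a..<a + n}" "\<And>i. i \<in> V \<Longrightarrow> i mod 3 \<noteq> r mod 3"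
    and "\<not> 3 dvd X_order p" "n \<le> k * X_order p" "3 \<le> k"
  shows "card (V \<inter> hits Q p) \<le> k - 1"
  using assms hits_diff by (intro card_residue_class_avoiding_le[of "X_order p" _ a n r k]) auto

text \<open>The subtracted numbers are twice the degrees of the factors of order \<open>5\<close>,
  \<open>7\<close>, \<open>9\<close>, \<open>15\<close>; the factor \<open>2\<close> counts the two
  polynomials of order \<open>7\<close> and of order \<open>15\<close>. Truncated subtraction
  replaces negative weights by \<open>0\<close>.\<close>

lemma weight_table_40:
  "\<forall>n\<in>{1..<41}. (5 * ((n + 4) div 5) - 8) + 2 * (5 * ((n + 6) div 7) - 6)
     + (5 * ((n + 8) div 9) - 12) + 2 * (5 * ((n + 14) div 15) - 8) < 3 * (n :: nat)"
  by (simp add: atLeastLessThan_nat_numeral)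

text \<open>The weight of \<open>p\<close> is five times the excess of the bound on the number of exponents it
  excludes over \<open>2 / 5\<close> of its degree.\<close>

lemma avoid_without_Phi3:
  assumes S: "finite S" "\<And>p. p \<in> S \<Longrightarrow> X_order_setting p" "Phi3 \<notin> S"
    and deg: "(\<Sum>p\<in>S. degree p) \<le> n" and n: "1 \<le> n" "n \<le> 40"
  shows "\<exists>i\<in>{a..<a + n}. \<forall>p\<in>S. i \<notin> hits Q p"
proof (rule exists_avoiding)
  let ?V = "{a..<a + n}"
  define t :: "bit poly \<Rightarrow> nat" where "t p =
    (if p = Phi5 then 5 * ((n + 4) div 5) - 8
     else if p = Phi7a \<or> p = Phi7b then 5 * ((n + 6) div 7) - 6
     else if p = Phi9 then 5 * ((n + 8) div 9) - 12
     else if p = Phi15a \<or> p = Phi15b then 5 * ((n + 14) div 15) - 8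
     else 0)" for p
  let ?T = "{Phi5, Phi7a, Phi7b, Phi9, Phi15a, Phi15b}"
  have le: "5 * card (?V \<inter> hits Q p) \<le> 2 * degree p + t p" if "p \<in> S" for p
  proof -
    interpret X_order_setting p using S(2)[OF that] .
    let ?e = "X_order p"
    have c: "card (?V \<inter> hits Q p) \<le> (n + ?e - 1) div ?e"
      using X_order_setting_axioms by (rule card_hits_le[where a = a]) simp
    have "?e \<noteq> 3"
      using order_3 S(3) that by blast
    then consider "?e = 5" | "?e = 7" | "?e = 9" | "?e = 15" | "?e \<notin> {3, 5, 7, 9, 15}"
      by auto
    then show ?thesis
    proof cases
      case 1
      with c order_5 show ?thesis by (auto simp: t_def add.commute)
    next
      case 2
      with c order_7 show ?thesis by (auto simp: t_def add.commute)
    next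
      case 3
      with c order_9 show ?thesis by (auto simp: t_def add.commute)
    next
      case 4
      with c order_15 show ?thesis by (auto simp: t_def add.commute)
    next
      case 5
      have "(n + ?e - 1) div ?e \<le> (39 + ?e) div ?e"
        using n by (intro div_le_mono) simp
      with c large_order(2)[OF 5] show ?thesis by linarith
    qed
  qed
  have "5 * (\<Sum>p\<in>S. card (?V \<inter> hits Q p)) \<le> (\<Sum>p\<in>S. 2 * degree p + t p)"
    unfolding sum_distrib_left using le by (rule sum_mono)
  also have "\<dots> = 2 * (\<Sum>p\<in>S. degree p) + (\<Sum>p\<in>S. t p)"
    by (simp add: sum.distrib sum_distrib_left)
  also have "(\<Sum>p\<in>S. t p) \<le> (\<Sum>p\<in>?T. t p)"
    using S(1) by (intro sum_le_sum_support) (auto simp: t_def)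
  also have "\<dots> = (5 * ((n + 4) div 5) - 8) + 2 * (5 * ((n + 6) div 7) - 6)
     + (5 * ((n + 8) div 9) - 12) + 2 * (5 * ((n + 14) div 15) - 8)"
    by (simp add: t_def)
  \<comment> \<open>The degrees spend at most \<open>2 * n\<close> of the budget
    \<open>5 * n\<close>.\<close>
  also have "\<dots> < 3 * n"
    using n by (intro bspec[OF weight_table_40]) simp
  finally show "(\<Sum>p\<in>S. card (?V \<inter> hits Q p)) < card ?V"
    using deg by simp
qed (use S in auto)

lemma card_avoiding_class_3:
  fixes a n r :: nat
  shows "n - (n + 2) div 3 \<le> card {i \<in> {a..<a + n}. i mod 3 \<noteq> r mod 3}"
proof -
  let ?A = "{i \<in> {a..<a + n}. i mod 3 = r mod 3}" and ?B = "{i \<in> {a..<a + n}. i mod 3 \<noteq> r mod 3}"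
  have "card ?A \<le> (n + 3 - 1) div 3"
    by (rule card_residue_class_le[of 3 _ a]) (auto intro: mod_eq_dvd_iff_nat[THEN iffD1])
  moreover have "card ?A + card ?B = card (?A \<union> ?B)"
    by (rule card_Un_disjoint[symmetric]) auto
  moreover have "?A \<union> ?B = {a..<a + n}"
    by auto
  ultimately have "card ?A \<le> (n + 2) div 3" "card ?A + card ?B = n"
    by simp_all
  then show ?thesis
    by linarith
qed

text \<open>The order of \<open>X\<close> modulo \<open>Phi3\<close> divides
  \<open>2 ^ 2 - 1\<close> and differs from \<open>1\<close>, so it is \<open>3\<close>.\<close>

lemma hits_Phi3_class:
  assumes "X_order_setting Phi3" "r \<in> hits Q Phi3" "i \<in> hits Q Phi3"
  shows "i mod 3 = r mod 3"
proof -
  interpret X_order_setting Phi3 by fact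
  have "X_order Phi3 dvd 3"
    using order_dvd by simp
  then have "X_order Phi3 \<le> 3"
    by (rule dvd_imp_le) simp
  then have "X_order Phi3 = 3"
    using odd_order order_ne_1 X_order_pos[OF irred not_X] by presburger
  with assms show ?thesis
    using hits_diff[OF assms(1), of i Q r] hits_diff[OF assms(1), of r Q i]
    by (metis mod_eq_dvd_iff_nat nat_le_linear)
qed

text \<open>Beside \<open>Phi3\<close> a degree of at most \<open>n - 2\<close> remains, and the
  right-hand side is three times a lower bound for the number of exponents outside its class. The
  thresholds are the window lengths at which the counts for orders \<open>5\<close>,
  \<open>7\<close> and \<open>15\<close> jump.\<close>

lemma weight_table_18:
  "\<forall>n\<in>{2..<19}. n - 2 + (if n \<le> 5 then 0 else if n \<le> 15 then 2 else 5)
     + 2 * (if n \<le> 7 then 0 else 3) + 2 * (if n \<le> 15 then 0 else 2) < 3 * (n - (n + 2) div (3 :: nat))"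
  by (simp add: atLeastLessThan_nat_numeral)

text \<open>The class modulo \<open>3\<close> excluded by \<open>Phi3\<close> is removed first; it contains every third term of the
  progressions with difference \<open>5\<close> and \<open>7\<close>. The weight is three times the excess over \<open>1 / 3\<close> of the
  degree.\<close>

lemma avoid_with_Phi3:
  assumes S: "finite S" "\<And>p. p \<in> S \<Longrightarrow> X_order_setting p" "Phi3 \<in> S"
    and r: "r \<in> hits Q Phi3"
    and deg: "(\<Sum>p\<in>S. degree p) \<le> n" and n: "n \<le> 18"
  shows "\<exists>i\<in>{a..<a + n}. \<forall>p\<in>S. i \<notin> hits Q p"
proof -
  let ?V = "{i \<in> {a..<a + n}. i mod 3 \<noteq> r mod 3}"
  let ?S = "S - {Phi3}"
  define t :: "bit poly \<Rightarrow> nat" where "t p =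
    (if p = Phi5 then (if n \<le> 5 then 0 else if n \<le> 15 then 2 else 5)
     else if p = Phi7a \<or> p = Phi7b then (if n \<le> 7 then 0 else 3)
     else if p = Phi15a \<or> p = Phi15b then (if n \<le> 15 then 0 else 2)
     else 0)" for p
  let ?T = "{Phi5, Phi7a, Phi7b, Phi15a, Phi15b}"
  have le: "3 * card (?V \<inter> hits Q p) \<le> degree p + t p" if p: "p \<in> ?S" for p
  proof -
    interpret X_order_setting p using S(2) p by blast
    let ?e = "X_order p"
    have c: "card (?V \<inter> hits Q p) \<le> (n + ?e - 1) div ?e"
      using X_order_setting_axioms by (rule card_hits_le[where a = a]) auto
    have c': "card (?V \<inter> hits Q p) \<le> k - 1" if "\<not> 3 dvd ?e" "n \<le> k * ?e" "3 \<le> k" for k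
      using X_order_setting_axioms _ _ that by (rule card_hits_avoiding_le[where a = a and r = r]) auto
    have "?e \<noteq> 3"
      using order_3 p by blast
    then consider "?e = 5" | "?e = 7" | "?e = 9" | "?e = 15" | "?e \<notin> {3, 5, 7, 9, 15}"
      by auto
    then show ?thesis
    proof cases
      case 1
      \<comment> \<open>Beyond \<open>n = 5\<close> one of the first three terms of the progression
        is lost to the class of \<open>Phi3\<close>: at most \<open>2\<close> exponents up to
        \<open>n = 15\<close>, at most \<open>3\<close> up to \<open>n = 20\<close>.\<close>
      have "(n + 5 - 1) div 5 \<le> 1" if "n \<le> 5"
        using that by linarith
      with 1 c c'[of 3] c'[of 4] order_5 n show ?thesis by (auto simp: t_def)
    next
      case 2
      have "(n + 7 - 1) div 7 \<le> 1" if "n \<le> 7"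
        using that by linarith
      with 2 c c'[of 3] order_7 n show ?thesis by (auto simp: t_def)
    next
      case 3
      \<comment> \<open>The degree \<open>6\<close> of \<open>Phi9\<close> pays for two exponents,
        so its weight is \<open>0\<close>.\<close>
      have "(n + 9 - 1) div 9 \<le> 2"
        using n by linarith
      with 3 c order_9 show ?thesis by (auto simp: t_def add.commute)
    next
      case 4
      have "(n + 15 - 1) div 15 \<le> 2" "n \<le> 15 \<Longrightarrow> (n + 15 - 1) div 15 \<le> 1"
        using n by linarith+
      with 4 c order_15 show ?thesis by (auto simp: t_def add.commute)
    next
      case 5
      have "(n + ?e - 1) div ?e \<le> (17 + ?e) div ?e"
        using n by (intro div_le_mono) simp
      with c large_order(3)[OF 5] show ?thesis by linarith
    qed
  qed
  have "(\<Sum>p\<in>S. degree p) = 2 + (\<Sum>p\<in>?S. degree p)"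
    using S(1,3) by (subst sum.remove[of _ Phi3]) auto
  with deg have deg': "(\<Sum>p\<in>?S. degree p) \<le> n - 2" and "2 \<le> n"
    by auto
  have "3 * (\<Sum>p\<in>?S. card (?V \<inter> hits Q p)) \<le> (\<Sum>p\<in>?S. degree p + t p)"
    unfolding sum_distrib_left using le by (rule sum_mono)
  also have "\<dots> = (\<Sum>p\<in>?S. degree p) + (\<Sum>p\<in>?S. t p)"
    by (simp add: sum.distrib)
  also have "(\<Sum>p\<in>?S. t p) \<le> (\<Sum>p\<in>?T. t p)"
    using S(1) by (intro sum_le_sum_support) (auto simp: t_def)
  also have "(\<Sum>p\<in>?T. t p) = (if n \<le> 5 then 0 else if n \<le> 15 then 2 else 5)
     + 2 * (if n \<le> 7 then 0 else 3) + 2 * (if n \<le> 15 then 0 else 2)" (is "_ = ?w")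
    by (simp add: t_def)
  also have "(\<Sum>p\<in>?S. degree p) + ?w \<le> n - 2 + ?w"
    using deg' by (rule add_right_mono)
  also have "\<dots> < 3 * (n - (n + 2) div 3)"
    unfolding add.assoc[symmetric] using n \<open>2 \<le> n\<close> by (intro bspec[OF weight_table_18]) simp
  also have "\<dots> \<le> 3 * card ?V"
    using card_avoiding_class_3 by simp
  finally have "(\<Sum>p\<in>?S. card (?V \<inter> hits Q p)) < card ?V"
    by simp
  then have "\<exists>i\<in>?V. \<forall>p\<in>?S. i \<notin> hits Q p"
    using S(1) by (intro exists_avoiding) auto
  then obtain i where i: "i \<in> ?V" "\<forall>p\<in>?S. i \<notin> hits Q p"
    by blast
  moreover have "i \<notin> hits Q Phi3"
    using hits_Phi3_class[OF S(2)[OF S(3)] r] i(1) by auto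
  ultimately show ?thesis
    by blast
qed

text \<open>If \<open>Phi3\<close> excludes nothing, each factor excludes at most \<open>3\<close>
  of the \<open>18\<close> exponents, \<open>Phi5\<close> at most \<open>4\<close>: at most
  \<open>16\<close> in all. Otherwise \<open>12\<close> exponents lie outside the class of
  \<open>Phi3\<close>, and the at most four other factors exclude \<open>2\<close> each,
  \<open>Phi5\<close> at most \<open>3\<close>: at most \<open>9\<close>.\<close>

lemma avoid_few:
  assumes S: "finite S" "\<And>p. p \<in> S \<Longrightarrow> X_order_setting p" "card S \<le> 5"
  shows "\<exists>i\<in>{a..<a + 18}. \<forall>p\<in>S. i \<notin> hits Q p"
proof (cases "Phi3 \<in> S \<and> hits Q Phi3 \<noteq> {}")
  case False
  let ?V = "{a..<a + 18}" and ?S = "S - {Phi3}"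
  have le: "card (?V \<inter> hits Q p) \<le> 3 + (if p = Phi5 then 1 else 0)" if p: "p \<in> ?S" for p
  proof -
    interpret X_order_setting p using S(2) p by blast
    let ?e = "X_order p"
    have c: "card (?V \<inter> hits Q p) \<le> (18 + ?e - 1) div ?e"
      using X_order_setting_axioms by (rule card_hits_le[where a = a]) simp
    have "?e \<noteq> 3"
      using order_3 p by blast
    then consider "?e = 5" | "7 \<le> ?e"
      using order_cases by fastforce
    then show ?thesis
    proof cases
      case 1
      with c order_5 show ?thesis by simp
    next
      case 2
      then have "(18 + ?e - 1) div ?e < 4"
        by (simp add: div_less_iff_less_mult)
      with c show ?thesis by simp
    qed
  qed
  have "(\<Sum>p\<in>?S. card (?V \<inter> hits Q p)) \<le> (\<Sum>p\<in>?S. 3 + (if p = Phi5 then 1 else 0))"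
    using le by (rule sum_mono)
  also have "\<dots> \<le> 3 * card ?S + 1"
    unfolding sum.distrib using S(1) by simp
  also have "card ?S \<le> 5"
    using S card_Diff1_le[of S] by (meson le_trans)
  finally have "\<exists>i\<in>?V. \<forall>p\<in>?S. i \<notin> hits Q p"
    using S(1) by (intro exists_avoiding) auto
  with False show ?thesis
    by blast
next
  case True
  then obtain r where r: "r \<in> hits Q Phi3" by blast
  let ?V = "{i \<in> {a..<a + 18}. i mod 3 \<noteq> r mod 3}" and ?S = "S - {Phi3}"
  have le: "card (?V \<inter> hits Q p) \<le> 2 + (if p = Phi5 then 1 else 0)" if p: "p \<in> ?S" for p
  proof -
    interpret X_order_setting p using S(2) p by blast
    let ?e = "X_order p"
    have c: "card (?V \<inter> hits Q p) \<le> (18 + ?e - 1) div ?e"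
      using X_order_setting_axioms by (rule card_hits_le[where a = a]) auto
    have c': "card (?V \<inter> hits Q p) \<le> k - 1" if "\<not> 3 dvd ?e" "18 \<le> k * ?e" "3 \<le> k" for k
      using X_order_setting_axioms _ _ that by (rule card_hits_avoiding_le[where a = a and r = r]) auto
    have "?e \<noteq> 3"
      using order_3 p by blast
    then consider "?e = 5" | "?e = 7" | "9 \<le> ?e"
      using order_cases by fastforce
    then show ?thesis
    proof cases
      case 1
      with c'[of 4] order_5 show ?thesis by simp
    next
      case 2
      with c'[of 3] show ?thesis by simp
    next
      case 3
      then have "(18 + ?e - 1) div ?e < 3"
        by (simp add: div_less_iff_less_mult)
      with c show ?thesis by simp
    qed
  qed
  have "(\<Sum>p\<in>?S. card (?V \<inter> hits Q p)) \<le> (\<Sum>p\<in>?S. 2 + (if p = Phi5 then 1 else 0))"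
    using le by (rule sum_mono)
  also have "\<dots> \<le> 2 * card ?S + 1"
    unfolding sum.distrib using S(1) by simp
  also have "card ?S \<le> 4"
    using S True by simp
  also have "2 * 4 + 1 < card ?V"
    using card_avoiding_class_3[of 18 a r] by simp
  finally have "\<exists>i\<in>?V. \<forall>p\<in>?S. i \<notin> hits Q p"
    using S(1) by (intro exists_avoiding) auto
  then obtain i where i: "i \<in> ?V" "\<forall>p\<in>?S. i \<notin> hits Q p"
    by blast
  moreover have "i \<notin> hits Q Phi3"
    using hits_Phi3_class[OF S(2) r] True i(1) by auto
  ultimately show ?thesis
    by blast
qed

lemma avoid:
  assumes S: "finite S" "\<And>p. p \<in> S \<Longrightarrow> X_order_setting p"
    and deg: "(\<Sum>p\<in>S. degree p) \<le> n" and n: "1 \<le> n"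
    and cases: "n \<le> 18 \<or> card S \<le> 5 \<or> n \<le> 40 \<and> Phi3 \<notin> S"
  shows "\<exists>i\<in>{a..<a + n}. \<forall>p\<in>S. i \<notin> hits Q p"
proof -
  consider "n \<le> 18" "Phi3 \<in> S" "hits Q Phi3 \<noteq> {}"
    | "n \<le> 40" "Phi3 \<notin> S \<or> hits Q Phi3 = {}"
    | "18 < n" "card S \<le> 5"
    using cases by linarith
  then show ?thesis
  proof cases
    case 1
    then show ?thesis
      using avoid_with_Phi3[OF S] deg by blast
  next
    case 2
    have "(\<Sum>p\<in>S - {Phi3}. degree p) \<le> (\<Sum>p\<in>S. degree p)"
      using S(1) by (intro sum_mono2) auto
    with deg have "\<exists>i\<in>{a..<a + n}. \<forall>p\<in>S - {Phi3}. i \<notin> hits Q p"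
      using S n 2 by (intro avoid_without_Phi3) auto
    with 2 show ?thesis
      by blast
  next
    case 3
    then show ?thesis
      using avoid_few[OF S, of a Q] by force
  qed
qed

lemma X_dvd_iff_bit: "[:0, 1:] dvd P \<longleftrightarrow> coeff P 0 = (0 :: bit)"
  using poly_eq_0_iff_dvd[of P 0] by (simp add: poly_0_coeff_0)

definition avoids :: "bit poly \<Rightarrow> bit poly \<Rightarrow> nat \<Rightarrow> bool" where
  "avoids P Q i \<longleftrightarrow> (\<forall>p. irreducible p \<and> p \<noteq> [:0, 1:] \<and> p \<noteq> [:1, 1:] \<and> p dvd P \<longrightarrow> \<not> p dvd Q + Xp i)"

text \<open>A factor \<open>X\<close> uses up one unit of degree without excluding an exponent,
  whence the alternative bound \<open>Suc n\<close>. The start \<open>a\<close> is free so that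
  exponent \<open>0\<close> can be skipped.\<close>

lemma exists_exponent:
  fixes P Q :: "bit poly"
  assumes "P \<noteq> 0" "1 \<le> n" "degree P \<le> n \<or> [:0, 1:] dvd P \<and> degree P \<le> Suc n"
    and "n \<le> 18 \<or> card (irreducible_factors P) \<le> 5 \<or> n \<le> 40 \<and> \<not> Phi3 dvd P"
  shows "\<exists>i\<in>{a..<a + n}. avoids P Q i"
proof -
  let ?S = "irreducible_factors P - {[:0, 1:], [:1, 1:]}"
  have fin: "finite (irreducible_factors P)"
    using assms(1) by (rule finite_irreducible_factors)
  have deg: "(\<Sum>p\<in>?S. degree p) \<le> n"
    using assms(3)
  proof
    assume "degree P \<le> n"
    moreover have "(\<Sum>p\<in>?S. degree p) \<le> degree P"
      using assms(1) fin by (intro sum_degree_irreducible_le_bit) (auto simp: irreducible_factors_def)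
    ultimately show ?thesis by simp
  next
    assume X: "[:0, 1:] dvd P \<and> degree P \<le> Suc n"
    have "(\<Sum>p\<in>insert [:0, 1:] ?S. degree p) \<le> degree P"
      using assms(1) fin X irreducible_X_bit
      by (intro sum_degree_irreducible_le_bit) (auto simp: irreducible_factors_def)
    with X fin show ?thesis by simp
  qed
  have "card ?S \<le> card (irreducible_factors P)"
    using fin by (intro card_mono) auto
  with assms(4) have "n \<le> 18 \<or> card ?S \<le> 5 \<or> n \<le> 40 \<and> Phi3 \<notin> ?S"
    by (auto simp: irreducible_factors_def)
  then have "\<exists>i\<in>{a..<a + n}. \<forall>p\<in>?S. i \<notin> hits Q p"
    using fin deg assms(2)
    by (intro avoid) (auto simp: irreducible_factors_def X_order_setting_def)
  then show ?thesis
    by (auto simp: avoids_def hits_def irreducible_factors_def)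
qed

section \<open>Square-freeness by reduction modulo \<open>2\<close>\<close>

lemma even_part_pCons: "even_part (pCons a p) = pCons a (odd_part p)"
  by (rule poly_eqI) (simp add: coeff_even_part coeff_odd_part coeff_pCons split: nat.split)

lemma odd_part_pCons: "odd_part (pCons a p) = even_part p"
  by (rule poly_eqI) (simp add: coeff_even_part coeff_odd_part coeff_pCons)

lemma even_part_add: "even_part (p + q) = even_part p + even_part q"
  by (rule poly_eqI) (simp add: coeff_even_part)

lemma odd_part_add: "odd_part (p + q) = odd_part p + odd_part q"
  by (rule poly_eqI) (simp add: coeff_odd_part)

lemma even_part_monom: "even_part (monom c (2 * i)) = monom c i" "even_part (monom c (2 * i + 1)) = 0"
  by (auto intro!: poly_eqI simp: coeff_even_part coeff_monom Suc_double_not_eq_double)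

lemma odd_part_monom: "odd_part (monom c (2 * i)) = 0" "odd_part (monom c (2 * i + 1)) = monom c i"
  by (auto intro!: poly_eqI simp: coeff_odd_part coeff_monom double_not_eq_Suc_double)

lemma degree_even_part: "degree (even_part p) \<le> degree p div 2"
  by (rule degree_le) (auto simp: coeff_even_part intro!: coeff_eq_0)

lemma degree_odd_part: "degree (odd_part p) \<le> (degree p - 1) div 2"
  by (rule degree_le) (auto simp: coeff_odd_part intro!: coeff_eq_0)

lemma square_add_bit: "(p + q) ^ 2 = p ^ 2 + q ^ 2" for p q :: "bit poly"
proof -
  have "(p + q) ^ 2 = p ^ 2 + q ^ 2 + (p * q + p * q)"
    by (simp only: power2_eq_square distrib_left distrib_right mult.commute[of q p] add.assoc
        add.left_commute add.commute)
  then show ?thesis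
    by (simp only: bit_poly_add_self add_0_right)
qed

text \<open>Prepending a coefficient swaps the two parts, and squaring is additive and fixes
  constants.\<close>

lemma even_odd_decomposition: "F = even_part F ^ 2 + [:0, 1:] * odd_part F ^ 2" for F :: "bit poly"
proof (induction F)
  case 0
  show ?case
    by (simp add: even_part_def odd_part_def)
next
  case (pCons a F)
  have a: "[:a:] ^ 2 = [:a:]"
    by (cases a) (auto simp: power2_eq_square)
  have split: "pCons b p = [:b:] + [:0, 1:] * p" for b and p :: "bit poly"
    by (cases b) (auto simp: one_pCons simp del: one_poly_eq_simps)
  have "pCons a F = [:a:] + [:0, 1:] * (even_part F ^ 2 + [:0, 1:] * odd_part F ^ 2)"
    using pCons.IH split by metis
  also have "\<dots> = [:a:] ^ 2 + ([:0, 1:] * odd_part F) ^ 2 + [:0, 1:] * even_part F ^ 2"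
    unfolding a by (simp only: power2_eq_square distrib_left ac_simps)
  also have "\<dots> = ([:a:] + [:0, 1:] * odd_part F) ^ 2 + [:0, 1:] * even_part F ^ 2"
    by (simp only: square_add_bit)
  finally show ?case
    unfolding even_part_pCons odd_part_pCons using split by metis
qed

lemma pderiv_square_bit: "pderiv (p ^ 2) = 0" for p :: "bit poly"
  by (simp only: power2_eq_square pderiv_mult mult.commute bit_poly_add_self)

lemma pderiv_bit: "pderiv F = odd_part F ^ 2" for F :: "bit poly"
proof -
  have "pderiv F = pderiv (even_part F ^ 2 + [:0, 1:] * odd_part F ^ 2)"
    using even_odd_decomposition by metis
  also have "\<dots> = odd_part F ^ 2"
    by (simp only: pderiv_add pderiv_mult pderiv_square_bit) (simp add: pderiv_pCons)
  finally show ?thesis .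
qed

text \<open>Squares have derivative \<open>0\<close>, so \<open>p ^ 2\<close> also divides the
  derivative, which is the square of the odd part; the decomposition then yields the even
  part.\<close>

lemma square_dvd_imp_dvd_parts:
  fixes p F :: "bit poly"
  assumes "irreducible p" "p ^ 2 dvd F"
  shows "p dvd even_part F" "p dvd odd_part F"
proof -
  have prime: "prime_elem p"
    using assms(1) by (rule bit_poly_irreducible_imp_prime)
  obtain k where k: "F = p ^ 2 * k"
    using assms(2) by blast
  have "p dvd p ^ 2"
    by (simp add: power2_eq_square)
  have "pderiv F = p ^ 2 * pderiv k"
    unfolding k by (simp only: pderiv_mult pderiv_square_bit mult_zero_right add_0_right)
  then have "p dvd odd_part F ^ 2"
    using \<open>p dvd p ^ 2\<close> by (simp add: pderiv_bit)
  then show "p dvd odd_part F"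
    using prime prime_elem_dvd_power by blast
  then have "p dvd [:0, 1:] * odd_part F ^ 2"
    unfolding power2_eq_square by (intro dvd_mult)
  moreover have "p dvd F"
    using k \<open>p dvd p ^ 2\<close> by simp
  ultimately have "p dvd even_part F ^ 2"
    using even_odd_decomposition dvd_add_left_iff by metis
  then show "p dvd even_part F"
    using prime prime_elem_dvd_power by blast
qed

section \<open>Reduction of integer polynomials modulo \<open>2\<close>\<close>

lemma of_int_bit: "(of_int k :: bit) = (if even k then 0 else 1)"
  by (auto elim!: evenE oddE)

lemma coeff_reduce_mod2: "coeff (reduce_mod2 f) i = of_int (coeff f i)"
  by (simp add: reduce_mod2_def coeff_map_poly)

lemma reduce_mod2_add: "reduce_mod2 (f + g) = reduce_mod2 f + reduce_mod2 g"
  by (rule poly_eqI) (simp add: coeff_reduce_mod2)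

lemma reduce_mod2_mult: "reduce_mod2 (f * g) = reduce_mod2 f * reduce_mod2 g"
  by (rule poly_eqI) (simp add: coeff_reduce_mod2 coeff_mult)

lemma reduce_mod2_monom: "reduce_mod2 (monom c j) = monom (of_int c) j"
  by (simp add: reduce_mod2_def map_poly_monom)

lemma poly_reduce_mod2_1: "poly (reduce_mod2 f) 1 = of_int (poly f 1)"
proof (induction f)
  case (pCons a f)
  then show ?case
    by (simp add: reduce_mod2_def map_poly_pCons)
qed (simp add: reduce_mod2_def)

text \<open>The irreducible factor \<open>X + 1\<close> needs no coprimality: if \<open>h\<^sup>2\<close> divides \<open>g\<close> and \<open>X + 1\<close> divides
  \<open>h\<close> modulo \<open>2\<close>, then \<open>h(1)\<close> is even and \<open>4\<close> divides \<open>g(1)\<close>.\<close>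

lemma square_free_by_reduction:
  assumes "odd (lead_coeff g)" "\<not> 4 dvd poly g 1"
    and "\<And>p. irreducible p \<Longrightarrow> p \<noteq> [:1, 1:] \<Longrightarrow> p dvd even_part (reduce_mod2 g) \<Longrightarrow>
           \<not> p dvd odd_part (reduce_mod2 g)"
  shows "square_free_poly g"
  unfolding square_free_poly_def
proof
  assume "\<exists>h. 1 \<le> degree h \<and> h ^ 2 dvd g"
  then obtain h where h: "1 \<le> degree h" "h ^ 2 dvd g"
    by blast
  then obtain k where g: "g = h * h * k"
    unfolding power2_eq_square by blast
  \<comment> \<open>This keeps \<open>h\<close> non-constant after reduction modulo
    \<open>2\<close>.\<close>
  have "odd (lead_coeff h)"
    using assms(1) unfolding g lead_coeff_mult by auto
  then have "1 \<le> degree (reduce_mod2 h)"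
    using h(1) by (simp add: degree_reduce_mod2)
  then obtain p where p: "irreducible p" "p dvd reduce_mod2 h"
    using exists_irreducible_factor_bit[of "reduce_mod2 h"] by auto
  have "reduce_mod2 g = reduce_mod2 h * reduce_mod2 h * reduce_mod2 k"
    by (simp add: g reduce_mod2_mult)
  then have "p ^ 2 dvd reduce_mod2 g"
    using p(2) by (simp add: power2_eq_square mult_dvd_mono)
  with p(1) have "p dvd even_part (reduce_mod2 g)" "p dvd odd_part (reduce_mod2 g)"
    by (rule square_dvd_imp_dvd_parts)+
  with assms(3) p(1) have "p = [:1, 1:]"
    by blast
  with p(2) have "poly (reduce_mod2 h) 1 = 0"
    by (auto elim!: dvdE)
  then have "even (poly h 1)"
    by (simp add: poly_reduce_mod2_1 of_int_bit split: if_splits)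
  then have "2 * 2 dvd poly h 1 * poly h 1"
    by (intro mult_dvd_mono)
  with assms(2) show False
    unfolding g by simp
qed

section \<open>Perturbing one coefficient\<close>

lemma poly_length_eq_sum:
  assumes "degree p \<le> n"
  shows "poly_length p = (\<Sum>i\<le>n. \<bar>coeff p i\<bar>)"
  unfolding poly_length_def using assms by (intro sum.mono_neutral_left) (auto intro: coeff_eq_0)

lemma poly_length_triangle: "poly_length (p + q) \<le> poly_length p + poly_length q"
proof -
  let ?n = "max (degree p) (degree q)"
  have "poly_length (p + q) = (\<Sum>i\<le>?n. \<bar>coeff p i + coeff q i\<bar>)"
    using poly_length_eq_sum[OF degree_add_le_max] by simp
  also have "\<dots> \<le> (\<Sum>i\<le>?n. \<bar>coeff p i\<bar> + \<bar>coeff q i\<bar>)"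
    by (intro sum_mono abs_triangle_ineq)
  also have "\<dots> = poly_length p + poly_length q"
    by (simp add: sum.distrib poly_length_eq_sum[of p ?n] poly_length_eq_sum[of q ?n])
  finally show ?thesis .
qed

lemma poly_length_monom: "poly_length (monom c j) = \<bar>c\<bar>"
  using poly_length_eq_sum[OF degree_monom_le] by (simp add: if_distrib cong: if_cong)

text \<open>The square of a non-constant polynomial has degree at least \<open>2\<close>. This
  covers the degrees for which \<open>degree f div 2\<close> leaves no exponent to choose.\<close>

lemma square_free_degree_le_1:
  assumes "f \<noteq> 0" "degree f \<le> 1"
  shows "\<exists>g. square_free_poly g \<and> degree g = degree f \<and> poly_length (f - g) \<le> 1"
proof (intro exI[of _ f] conjI)
  show "square_free_poly f"
    unfolding square_free_poly_def
  proof
    assume "\<exists>h. 1 \<le> degree h \<and> h ^ 2 dvd f"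
    then obtain h where h: "1 \<le> degree h" "h ^ 2 dvd f"
      by blast
    then have "degree (h ^ 2) \<le> degree f"
      using assms(1) by (intro dvd_imp_degree_le)
    moreover have "degree (h ^ 2) = 2 * degree h"
      by (rule degree_power_eq) (use h in auto)
    ultimately show False
      using h(1) assms(2) by simp
  qed
qed (simp_all add: poly_length_def)

lemma perturb_monom:
  assumes "odd (lead_coeff f)" "j < degree f"
  shows "degree (f + monom c j) = degree f" "lead_coeff (f + monom c j) = lead_coeff f"
proof -
  have "degree (monom c j) < degree f"
    using assms(2) degree_monom_le le_less_trans by blast
  then show *: "degree (f + monom c j) = degree f"
    by (rule degree_add_eq_left)
  show "lead_coeff (f + monom c j) = lead_coeff f"
    unfolding * using assms(2) by simp
qed

text \<open>The values \<open>f(1) + 1\<close> and \<open>f(1) - 1\<close> differ by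
  \<open>2\<close>, so at most one is divisible by \<open>4\<close>; both signs have the same
  reduction modulo \<open>2\<close>.\<close>

lemma perturb:
  assumes "odd (lead_coeff f)" "j < degree f"
    and "\<And>p. irreducible p \<Longrightarrow> p \<noteq> [:1, 1:] \<Longrightarrow> p dvd even_part (reduce_mod2 f + Xp j) \<Longrightarrow>
           \<not> p dvd odd_part (reduce_mod2 f + Xp j)"
  shows "\<exists>g. square_free_poly g \<and> degree g = degree f \<and> poly_length (f - g) \<le> 1"
proof -
  obtain c :: int where c: "c = 1 \<or> c = - 1" "\<not> 4 dvd poly f 1 + c"
  proof (cases "4 dvd poly f 1 + 1")
    case True
    then have "\<not> 4 dvd poly f 1 + - 1"
      by presburger
    then show ?thesis
      using that by blast
  qed (use that in blast)
  let ?g = "f + monom c j"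
  have "(of_int c :: bit) = 1"
    using c(1) by auto
  then have red: "reduce_mod2 ?g = reduce_mod2 f + Xp j"
    by (simp add: reduce_mod2_add reduce_mod2_monom)
  have "square_free_poly ?g"
  proof (rule square_free_by_reduction)
    show "odd (lead_coeff ?g)"
      using perturb_monom(2)[OF assms(1,2)] assms(1) by simp
    show "\<not> 4 dvd poly ?g 1"
      using c(2) by (simp add: poly_monom)
  qed (unfold red, rule assms(3))
  moreover have "f - ?g = monom (- c) j"
    by (simp add: minus_monom)
  then have "poly_length (f - ?g) \<le> 1"
    using c(1) by (auto simp: poly_length_monom)
  ultimately show ?thesis
    using perturb_monom(1)[OF assms(1,2)] by blast
qed

lemma perturb_even_part:
  assumes "odd (lead_coeff f)" "2 * i < degree f"
    and "\<And>p. irreducible p \<Longrightarrow> p \<noteq> [:1, 1:] \<Longrightarrow> p dvd odd_part (reduce_mod2 f) \<Longrightarrow>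
           \<not> p dvd even_part (reduce_mod2 f) + Xp i"
  shows "\<exists>g. square_free_poly g \<and> degree g = degree f \<and> poly_length (f - g) \<le> 1"
proof -
  have eq: "even_part (reduce_mod2 f + Xp (2 * i)) = even_part (reduce_mod2 f) + Xp i"
    "odd_part (reduce_mod2 f + Xp (2 * i)) = odd_part (reduce_mod2 f)"
    by (simp_all only: even_part_add odd_part_add even_part_monom odd_part_monom add_0_right)
  show ?thesis
    by (rule perturb[OF assms(1,2)]) (unfold eq, use assms(3) in blast)
qed

lemma perturb_odd_part:
  assumes "odd (lead_coeff f)" "2 * i + 1 < degree f"
    and "\<And>p. irreducible p \<Longrightarrow> p \<noteq> [:1, 1:] \<Longrightarrow> p dvd even_part (reduce_mod2 f) \<Longrightarrow>
           \<not> p dvd odd_part (reduce_mod2 f) + Xp i"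
  shows "\<exists>g. square_free_poly g \<and> degree g = degree f \<and> poly_length (f - g) \<le> 1"
proof -
  have eq: "even_part (reduce_mod2 f + Xp (2 * i + 1)) = even_part (reduce_mod2 f)"
    "odd_part (reduce_mod2 f + Xp (2 * i + 1)) = odd_part (reduce_mod2 f) + Xp i"
    by (simp_all only: even_part_add odd_part_add even_part_monom odd_part_monom add_0_right)
  show ?thesis
    by (rule perturb[OF assms(1,2)]) (unfold eq, use assms(3) in blast)
qed

text \<open>There are \<open>degree f div 2\<close> odd exponents \<open>2 * i + 1\<close> below the
  degree, as many as the even part may have degree; this number is at most \<open>18\<close> or
  \<open>40\<close> for degree at most \<open>37\<close> or \<open>81\<close>.\<close>

lemma square_free_near_odd_constant:
  assumes "odd (lead_coeff f)" "\<not> [:0, 1:] dvd even_part (reduce_mod2 f)"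
    and "degree f \<le> 37 \<or> card (irreducible_factors (even_part (reduce_mod2 f))) \<le> 5
           \<or> degree f \<le> 81 \<and> \<not> Phi3 dvd even_part (reduce_mod2 f)"
  shows "\<exists>g. square_free_poly g \<and> degree g = degree f \<and> poly_length (f - g) \<le> 1"
proof (cases "degree f \<le> 1")
  case True
  with assms(1) show ?thesis
    by (intro square_free_degree_le_1) auto
next
  case False
  let ?E = "even_part (reduce_mod2 f)" and ?n = "degree f div 2"
  have "?E \<noteq> 0"
    using assms(2) by auto
  moreover have "degree ?E \<le> ?n"
    using degree_even_part[of "reduce_mod2 f"] by (simp add: degree_reduce_mod2[OF assms(1)])
  moreover have "?n \<le> 18 \<or> card (irreducible_factors ?E) \<le> 5 \<or> ?n \<le> 40 \<and> \<not> Phi3 dvd ?E"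
    using assms(3) by auto
  moreover have "1 \<le> ?n"
    using False by simp
  ultimately obtain i where i: "i \<in> {0..<0 + ?n}"
    "avoids ?E (odd_part (reduce_mod2 f)) i"
    using exists_exponent[of ?E ?n 0 "odd_part (reduce_mod2 f)"] by blast
  then have "2 * i + 1 < degree f"
    by auto
  with assms(1) show ?thesis
    by (rule perturb_odd_part) (use i(2) assms(2) in \<open>auto simp: avoids_def\<close>)
qed

section \<open>The four statements\<close>

lemma X_dvd_add_Xp_iff:
  "[:0, 1:] dvd Q + Xp i \<longleftrightarrow> (if i = 0 then coeff Q 0 = 1 else coeff Q 0 = 0)"
  by (cases "coeff Q 0") (auto simp: X_dvd_iff_bit coeff_monom)

theorem theorem5p6:
  shows "(\<forall>f :: int poly.
            degree f \<le> 36 \<and> odd (lead_coeff f) \<and> odd (coeff f 0) \<longrightarrow>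
            (\<exists>g. square_free_poly g \<and> degree g = degree f \<and> poly_length (f - g) \<le> 1))
       \<and> (\<forall>f :: int poly.
            degree f \<le> 37 \<and> odd (lead_coeff f) \<and> even (coeff f 0) \<and>
            order 0 (reduce_mod2 f) = 1 \<longrightarrow>
            (\<exists>g. square_free_poly g \<and> degree g = degree f \<and> poly_length (f - g) \<le> 1))
       \<and> (\<forall>f :: int poly.
            degree f \<le> 81 \<and> odd (lead_coeff f) \<and> odd (coeff f 0) \<longrightarrow>
            (\<exists>g. square_free_poly g \<and> degree g = degree f \<and> poly_length (f - g) \<le> 3))
       \<and> (\<forall>f :: int poly.
            degree f \<ge> 9 \<and> odd (lead_coeff f) \<and>
            (no_small_factor (even_part (reduce_mod2 f)) \<and>
               finite (irreducible_factors (odd_part (reduce_mod2 f))) \<and>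
               card (irreducible_factors (odd_part (reduce_mod2 f))) \<le> 5
             \<or> no_small_factor (odd_part (reduce_mod2 f)) \<and>
               finite (irreducible_factors (even_part (reduce_mod2 f))) \<and>
               card (irreducible_factors (even_part (reduce_mod2 f))) \<le> 5) \<longrightarrow>
            (\<exists>g. square_free_poly g \<and> degree g = degree f \<and> poly_length (f - g) \<le> 1))"
proof (intro conjI allI impI; elim conjE)
  fix f :: "int poly"
  assume "degree f \<le> 36" "odd (lead_coeff f)" "odd (coeff f 0)"
  then show "\<exists>g. square_free_poly g \<and> degree g = degree f \<and> poly_length (f - g) \<le> 1"
    by (intro square_free_near_odd_constant)
      (auto simp: X_dvd_iff_bit coeff_even_part coeff_reduce_mod2 of_int_bit)
next
  fix f :: "int poly"
  let ?F = "reduce_mod2 f"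
  let ?E = "even_part ?F" and ?O = "odd_part ?F"
  assume f: "degree f \<le> 37" "odd (lead_coeff f)" "even (coeff f 0)" "order 0 ?F = 1"
  have "degree f \<noteq> 0"
    using f(2,3) by (intro notI) simp
  have "?F \<noteq> 0"
    using degree_reduce_mod2[OF f(2)] \<open>degree f \<noteq> 0\<close> by auto
  \<comment> \<open>Otherwise \<open>X ^ 2\<close> would divide the reduction, against the simple
    root at \<open>0\<close>.\<close>
  have O0: "coeff ?O 0 = 1"
  proof (rule ccontr)
    assume "coeff ?O 0 \<noteq> 1"
    then have "coeff ?F 1 = 0"
      by (simp add: coeff_odd_part)
    moreover have "coeff ?F 0 = 0"
      using f(3) by (simp add: coeff_reduce_mod2 of_int_bit)
    ultimately have "monom 1 2 dvd ?F"
      by (auto simp: monom_1_dvd_iff' less_Suc_eq numeral_2_eq_2)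
    then have "[:- 0, 1:] ^ 2 dvd ?F"
      by (simp add: monom_altdef)
    with \<open>?F \<noteq> 0\<close> f(4) show False
      unfolding order_divides by simp
  qed
  \<comment> \<open>The maximum keeps the window nonempty in degrees \<open>1\<close> and
    \<open>2\<close>, where \<open>i = 0\<close> is still admissible.\<close>
  let ?n = "max 1 ((degree f - 1) div 2)"
  have "?O \<noteq> 0"
    using O0 by auto
  moreover have "degree ?O \<le> ?n"
    using degree_odd_part[of ?F] by (simp add: degree_reduce_mod2[OF f(2)])
  moreover have "?n \<le> 18" "1 \<le> ?n"
    using f(1) by auto
  ultimately obtain i where i: "i \<in> {0..<0 + ?n}"
    "avoids ?O ?E i"
    using exists_exponent[of ?O ?n 0 ?E] by blast
  have "2 * i < degree f"
    using i(1) \<open>degree f \<noteq> 0\<close> by (auto simp: max_def split: if_splits)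
  with f(2) show "\<exists>g. square_free_poly g \<and> degree g = degree f \<and> poly_length (f - g) \<le> 1"
  proof (rule perturb_even_part)
    show "\<not> p dvd ?E + Xp i" if "irreducible p" "p \<noteq> [:1, 1:]" "p dvd ?O" for p
      using that i(2) O0 by (cases "p = [:0, 1:]") (auto simp: X_dvd_iff_bit avoids_def)
  qed
next
  fix f :: "int poly"
  let ?E = "even_part (reduce_mod2 f)"
  assume f: "degree f \<le> 81" "odd (lead_coeff f)" "odd (coeff f 0)"
  have E0: "coeff ?E 0 = 1"
    using f(3) by (simp add: coeff_even_part coeff_reduce_mod2 of_int_bit)
  show "\<exists>g. square_free_poly g \<and> degree g = degree f \<and> poly_length (f - g) \<le> 3"
  proof (cases "Phi3 dvd ?E")
    case False
    then obtain g where "square_free_poly g" "degree g = degree f" "poly_length (f - g) \<le> 1"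
      using square_free_near_odd_constant[of f] f E0 by (auto simp: X_dvd_iff_bit)
    then show ?thesis
      by (intro exI[of _ g]) simp
  next
    case True
    have "?E \<noteq> 0"
      using E0 by auto
    \<comment> \<open>This makes the degree of \<open>f\<close> large enough for adding
      \<open>x ^ 2\<close> to leave the leading term alone.\<close>
    with True have "degree Phi3 \<le> degree ?E"
      by (rule dvd_imp_degree_le)
    then have deg: "2 < degree f"
      using degree_even_part[of "reduce_mod2 f"] by (simp add: degree_reduce_mod2[OF f(2)])
    \<comment> \<open>The even part changes by \<open>X\<close>: \<open>Phi3\<close> no longer
      divides it, and its constant coefficient stays \<open>1\<close>. The total cost is at most
      \<open>2\<close>.\<close>
    let ?f = "f + monom 1 2"
    have red: "even_part (reduce_mod2 ?f) = ?E + Xp 1"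
      using even_part_monom(1)[of "1 :: bit" 1]
      by (simp add: reduce_mod2_add reduce_mod2_monom even_part_add)
    have "\<not> Phi3 dvd Xp 1"
      using dvd_imp_degree_le[of Phi3 "Xp 1"] by (auto simp: degree_monom_eq)
    with True have "\<not> Phi3 dvd ?E + Xp 1"
      using dvd_add_right_iff by blast
    moreover have "\<not> [:0, 1:] dvd ?E + Xp 1"
      using E0 by (simp add: X_dvd_add_Xp_iff)
    ultimately obtain g where g: "square_free_poly g" "degree g = degree ?f"
      "poly_length (?f - g) \<le> 1"
      using square_free_near_odd_constant[of ?f] f(1,2) perturb_monom[OF f(2) deg, of 1]
      unfolding red by auto
    have "f - g = monom (- 1) 2 + (?f - g)"
      by (simp flip: minus_monom)
    then have "poly_length (f - g) \<le> poly_length (monom (- 1) 2) + poly_length (?f - g)"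
      using poly_length_triangle by metis
    with g(3) have "poly_length (f - g) \<le> 3"
      by (simp add: poly_length_monom)
    with g perturb_monom(1)[OF f(2) deg] show ?thesis
      by auto
  qed
next
  fix f :: "int poly"
  let ?F = "reduce_mod2 f"
  let ?E = "even_part ?F" and ?O = "odd_part ?F"
  assume f: "9 \<le> degree f" "odd (lead_coeff f)"
  assume "no_small_factor ?E \<and> finite (irreducible_factors ?O) \<and> card (irreducible_factors ?O) \<le> 5
    \<or> no_small_factor ?O \<and> finite (irreducible_factors ?E) \<and> card (irreducible_factors ?E) \<le> 5"
  then show "\<exists>g. square_free_poly g \<and> degree g = degree f \<and> poly_length (f - g) \<le> 1"
  proof (elim disjE conjE)
    assume E: "no_small_factor ?E" and "finite (irreducible_factors ?O)"
      and card: "card (irreducible_factors ?O) \<le> 5"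
    let ?n = "(degree f - 1) div 2"
    have E0: "coeff ?E 0 = 1"
      using E by (simp add: no_small_factor_def X_dvd_iff_bit)
    have "?O \<noteq> 0"
      using \<open>finite (irreducible_factors ?O)\<close> irreducible_factors_0 by metis
    moreover have "degree ?O \<le> ?n"
      using degree_odd_part[of ?F] by (simp add: degree_reduce_mod2[OF f(2)])
    moreover have "1 \<le> ?n"
      using f(1) by simp
    \<comment> \<open>Starting at \<open>1\<close> preserves the constant coefficient of
      \<open>?E\<close>, so a factor \<open>X\<close> of \<open>?O\<close> does no harm.\<close>
    ultimately obtain i where i: "i \<in> {1..<1 + ?n}"
      "avoids ?O ?E i"
      using exists_exponent[of ?O ?n 1 ?E] card by blast
    have "2 * i < degree f"
      using i(1) f(1) by auto
    with f(2) show ?thesis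
    proof (rule perturb_even_part)
      show "\<not> p dvd ?E + Xp i" if "irreducible p" "p \<noteq> [:1, 1:]" "p dvd ?O" for p
        using that i E0 by (cases "p = [:0, 1:]") (auto simp: X_dvd_add_Xp_iff avoids_def)
    qed
  next
    assume O: "no_small_factor ?O" and "finite (irreducible_factors ?E)"
      and card: "card (irreducible_factors ?E) \<le> 5"
    have O0: "coeff ?O 0 = 1"
      using O by (simp add: no_small_factor_def X_dvd_iff_bit)
    show ?thesis
    proof (cases "[:0, 1:] dvd ?E")
      case False
      with f(2) card show ?thesis
        by (intro square_free_near_odd_constant) auto
    next
      case True
      \<comment> \<open>Exponent \<open>0\<close> is skipped to keep the constant coefficient of
        \<open>?O\<close>; the factor \<open>X\<close> of \<open>?E\<close> makes up for the lost
        exponent.\<close>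
      let ?n = "degree f div 2 - 1"
      have "?E \<noteq> 0"
        using \<open>finite (irreducible_factors ?E)\<close> irreducible_factors_0 by metis
      moreover have "degree ?E \<le> Suc ?n"
        using degree_even_part[of ?F] by (simp add: degree_reduce_mod2[OF f(2)])
      moreover have "1 \<le> ?n"
        using f(1) by simp
      ultimately obtain i where i: "i \<in> {1..<1 + ?n}"
        "avoids ?E ?O i"
        using exists_exponent[of ?E ?n 1 ?O] card True by blast
      have "2 * i + 1 < degree f"
        using i(1) f(1) by auto
      with f(2) show ?thesis
      proof (rule perturb_odd_part)
        show "\<not> p dvd ?O + Xp i" if "irreducible p" "p \<noteq> [:1, 1:]" "p dvd ?E" for p
          using that i O0 by (cases "p = [:0, 1:]") (auto simp: X_dvd_add_Xp_iff avoids_def)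
      qed
    qed
  qed
qed

end
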